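(* Let $n,i,j,p$ be integers with $0<i<j<n/2$, $\gcd(n,i,j)=1$ and $p\ge1$, such that either $i=1$ or neither $i$ nor $j$ is a unit in $\mathbb{Z}_n$. If $p\ge2$ and $H'=\{\pm1\}$, then $$\operatorname{Det}(C_n(i,j_\div p))=1,\quad \operatorname{Dist}(C_n(i,j_\div p))=2,\quad \rho(C_n(i,j_\div p))=1.$$ Otherwise, $\operatorname{Det}(C_n(i,j_\div p))=\operatorname{Dist}(C_n(i,j_\div p))=\rho(C_n(i,j_\div p))=2$.
   Context: The subdivided circulant graph $C_n(i,j_\div p)$ has vertices $u_a$ ($a\in\mathbb{Z}_n$) and $v_a^r$ ($a\in\mathbb{Z}_n$, $1\le r\le p$), with edges $u_au_{a+i}$ for all $a\in\mathbb{Z}_n$, and, for each $a\in\mathbb{Z}_n$, the edges of the path $(u_a,v_a^1,v_a^2,\dots,v_a^p,u_{a+j})$. $U(n)$ is the group of units of $\mathbb{Z}_n$, and $H'=\{t\in U(n): t\{\pm i\}=\{\pm i\}\text{ and }t\{\pm j\}=\{\pm j\}\}$. A determining set of a graph $G$ is a vertex subset $W$ such that only the identity automorphism fixes every vertex of $W$; $\operatorname{Det}(G)$ is the minimum size of a determining set. A $d$-distinguishing coloring is an assignment of $d$ colors to the vertices such that only the identity automorphism preserves every color class setwise; $\operatorname{Dist}(G)$ is the minimum such $d$. If $\operatorname{Dist}(G)=2$, the cost $\rho(G)$ is the minimum size of a color class over all 2-distinguishing colorings of $G$. *)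

theory Defs
  imports "HOL-Number_Theory.Residues" "HOL-Combinatorics.Permutations"
begin

section \<open>Symmetry breaking in finite simple graphs\<close>

record 'a sgraph =
  verts :: "'a set"
  edges :: "'a set set"

text \<open>
  An automorphism is extended by the identity outside the vertex set (this is part of
  \<^const>\<open>permutes\<close>), so the identity automorphism is exactly \<^term>\<open>id\<close>.
\<close>

definition automorphism :: "'a sgraph \<Rightarrow> ('a \<Rightarrow> 'a) \<Rightarrow> bool" where
  "automorphism G \<phi> \<longleftrightarrow>
     \<phi> permutes verts G \<and>
     (\<forall>x\<in>verts G. \<forall>y\<in>verts G. {\<phi> x, \<phi> y} \<in> edges G \<longleftrightarrow> {x, y} \<in> edges G)"

definition determining_set :: "'a sgraph \<Rightarrow> 'a set \<Rightarrow> bool" where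
  "determining_set G W \<longleftrightarrow>
     W \<subseteq> verts G \<and> (\<forall>\<phi>. automorphism G \<phi> \<and> (\<forall>w\<in>W. \<phi> w = w) \<longrightarrow> \<phi> = id)"

definition Det :: "'a sgraph \<Rightarrow> nat" where
  "Det G = (LEAST k. \<exists>W. finite W \<and> determining_set G W \<and> card W = k)"

definition color_class :: "'a sgraph \<Rightarrow> ('a \<Rightarrow> nat) \<Rightarrow> nat \<Rightarrow> 'a set" where
  "color_class G c q = {x \<in> verts G. c x = q}"

text \<open>The \<open>d\<close> colors are \<open>0, \<dots>, d - 1\<close>; not all of them need to be used.\<close>

definition distinguishing_coloring :: "'a sgraph \<Rightarrow> nat \<Rightarrow> ('a \<Rightarrow> nat) \<Rightarrow> bool" where
  "distinguishing_coloring G d c \<longleftrightarrow>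
     (\<forall>x\<in>verts G. c x < d) \<and>
     (\<forall>\<phi>. automorphism G \<phi> \<and> (\<forall>q<d. \<phi> ` color_class G c q = color_class G c q) \<longrightarrow> \<phi> = id)"

definition Dist :: "'a sgraph \<Rightarrow> nat" where
  "Dist G = (LEAST d. \<exists>c. distinguishing_coloring G d c)"

text \<open>Only meaningful for finite graphs with \<^term>\<open>Dist G = 2\<close>.\<close>

definition cost :: "'a sgraph \<Rightarrow> nat" where
  "cost G = (LEAST k. \<exists>c q. distinguishing_coloring G 2 c \<and> q < 2 \<and>
               finite (color_class G c q) \<and> card (color_class G c q) = k)"


section \<open>Subdivided circulant graphs\<close>

text \<open>
  \<open>\<int>\<^sub>n\<close> is represented by the carrier \<open>{0..n - 1}\<close> of \<^term>\<open>residue_ring n\<close>.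
  The term \<open>U a\<close> stands for \<open>u\<^sub>a\<close>, and \<open>V a r\<close> for the \<open>r\<close>-th vertex \<open>v\<^sub>a\<^sup>r\<close> subdividing
  the edge from \<open>u\<^sub>a\<close> to \<open>u\<close> at \<open>a + j\<close>.
\<close>

datatype scvertex = U int | V int nat

text \<open>The \<open>r\<close>-th vertex, counted from \<open>0\<close> to \<open>p + 1\<close>, of the path
  \<open>(u\<^sub>a, v\<^sub>a\<^sup>1, \<dots>, v\<^sub>a\<^sup>p, u)\<close> ending at index \<open>a + j\<close>.\<close>

definition sub_path :: "int \<Rightarrow> int \<Rightarrow> nat \<Rightarrow> int \<Rightarrow> nat \<Rightarrow> scvertex" where
  "sub_path n j p a r =
     (if r = 0 then U a else if r \<le> p then V a r else U ((a + j) mod n))"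

definition subdivided_circulant :: "int \<Rightarrow> int \<Rightarrow> int \<Rightarrow> nat \<Rightarrow> scvertex sgraph" where
  "subdivided_circulant n i j p =
     \<lparr>verts = {U a | a. a \<in> carrier (residue_ring n)} \<union>
              {V a r | a r. a \<in> carrier (residue_ring n) \<and> 1 \<le> r \<and> r \<le> p},
      edges = {{U a, U ((a + i) mod n)} | a. a \<in> carrier (residue_ring n)} \<union>
              {{sub_path n j p a r, sub_path n j p a (r + 1)} | a r.
                 a \<in> carrier (residue_ring n) \<and> r \<le> p}\<rparr>"

definition plus_minus :: "int \<Rightarrow> int \<Rightarrow> int set" where
  "plus_minus n x = {x mod n, (- x) mod n}"

definition unit_stabilizer :: "int \<Rightarrow> int \<Rightarrow> int \<Rightarrow> int set" where
  "unit_stabilizer n i j =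
     {t \<in> Units (residue_ring n).
        (\<lambda>x. t \<otimes>\<^bsub>residue_ring n\<^esub> x) ` plus_minus n i = plus_minus n i \<and>
        (\<lambda>x. t \<otimes>\<^bsub>residue_ring n\<^esub> x) ` plus_minus n j = plus_minus n j}"

end

theory Submission
  imports Defs
begin

text \<open>
  The vertices \<open>u\<^sub>a\<close> have degree four and the subdividing vertices degree two, so an automorphism
  permutes the \<open>u\<^sub>a\<close>, and therefore also the edges of length \<open>i\<close> and the subdivided paths of
  length \<open>j\<close>. On indices it is thus a permutation \<open>f\<close> of \<open>\<int>\<^sub>n\<close> with
  \<open>f (a + i) = f a \<plusminus> i\<close> and \<open>f (a + j) = f a \<plusminus> j\<close>. By injectivity the first sign is
  constant on the cosets of the subgroup generated by \<open>i\<close>. Going around the parallelogram \<open>a, a + i, a + i + j, a + j\<close>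
  in the two possible ways shows that the second sign is also unchanged by adding \<open>i\<close>, unless
  \<open>2 (i + j) = n\<close>. That exception makes \<open>i\<close> or \<open>j\<close> a unit, so under the unit hypothesis it
  only occurs for \<open>i = 1\<close>, where the first sign alone determines \<open>f\<close>. In all cases \<open>f\<close> is affine,
  \<open>f a = c + t a\<close>, with \<open>t\<close> in the stabilizer \<open>H'\<close> of \<open>\<plusminus>i\<close> and \<open>\<plusminus>j\<close>
  (\<open>automorphism_affine\<close>).

  If \<open>p \<ge> 2\<close> and \<open>H' = {\<plusminus>1}\<close>, an automorphism fixing \<open>v\<^sub>0\<^sup>1\<close> fixes its only neighbour of degree
  four, \<open>u\<^sub>0\<close>, hence the whole path leaving \<open>u\<^sub>0\<close>; so \<open>c = 0\<close>, \<open>t j = j\<close> and \<open>t = 1\<close>. Otherwise every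
  vertex is fixed by a nontrivial involution \<open>a \<mapsto> c + t a\<close>: a reflection for the \<open>u\<^sub>a\<close>; for a
  subdividing vertex, the reversal of its path when \<open>p = 1\<close>, or a \<open>t \<noteq> \<plusminus>1\<close> in \<open>H'\<close>
  with \<open>t j = j\<close>. This gives the lower bound \<open>2\<close>, which the set \<open>{u\<^sub>0, v\<^sub>i\<^sup>1}\<close> attains: its two
  members cannot be exchanged, and fixing both forces \<open>t i = i\<close> and \<open>t j = j\<close>.

  All three parameters are read off at once, because each color class of a 2-distinguishing coloring
  is a determining set, while a set whose setwise stabilizer is trivial is a color class of such a
  coloring (\<open>Det_Dist_cost_eqI\<close>).
\<close>

section \<open>Bounds for the symmetry-breaking parameters\<close>

lemma automorphism_of_involution:
  assumes vert: "\<And>x. x \<in> verts G \<Longrightarrow> f x \<in> verts G"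
    and invol: "\<And>x. x \<in> verts G \<Longrightarrow> f (f x) = x"
    and outside: "\<And>x. x \<notin> verts G \<Longrightarrow> f x = x"
    and edge: "\<And>x y. x \<in> verts G \<Longrightarrow> y \<in> verts G \<Longrightarrow> {x, y} \<in> edges G \<Longrightarrow> {f x, f y} \<in> edges G"
  shows "automorphism G f"
proof -
  have "bij_betw f (verts G) (verts G)"
    using vert invol by (intro bij_betw_byWitness[where f' = f]) auto
  then have "f permutes verts G"
    using outside by (rule bij_imp_permutes)
  moreover have "{f x, f y} \<in> edges G \<longleftrightarrow> {x, y} \<in> edges G"
    if "x \<in> verts G" "y \<in> verts G" for x y
    using edge[OF that] edge[OF vert[OF that(1)] vert[OF that(2)]] invol that by auto
  ultimately show ?thesis
    by (simp add: automorphism_def)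
qed

text \<open>
  A 2-coloring is determined by either of its classes, so \<open>W\<close> is one class of a distinguishing
  coloring. In the other direction, an automorphism fixing a class pointwise also preserves its
  complement; hence classes are determining sets and the bound \<open>min\<close> on determining sets limits
  the cost as well.
\<close>
lemma Det_Dist_cost_eqI:
  assumes fin: "finite (verts G)"
    and W: "W \<subseteq> verts G"
    and stab: "\<And>\<phi>. automorphism G \<phi> \<Longrightarrow> \<phi> ` W = W \<Longrightarrow> \<phi> = id"
    and min: "\<And>S. determining_set G S \<Longrightarrow> card W \<le> card S"
    and symmetric: "automorphism G \<psi>" "\<psi> \<noteq> id"
  shows "Det G = card W" and "Dist G = 2" and "cost G = card W"
proof -
  define c where "c x = (if x \<in> W then 0 else 1 :: nat)" for x
  have class0: "color_class G c 0 = W"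
    using W by (auto simp: color_class_def c_def)
  have c: "distinguishing_coloring G 2 c"
    unfolding distinguishing_coloring_def
  proof (intro conjI ballI allI impI)
    fix \<phi> assume *: "automorphism G \<phi> \<and> (\<forall>q<2. \<phi> ` color_class G c q = color_class G c q)"
    then have "\<phi> ` color_class G c 0 = color_class G c 0" by simp
    then show "\<phi> = id" using stab * class0 by simp
  qed (simp add: c_def)
  have "determining_set G W"
    using W stab unfolding determining_set_def by (metis image_cong image_ident)
  then show "Det G = card W"
    unfolding Det_def using W fin min
    by (intro Least_equality) (auto intro: finite_subset)
  \<comment> \<open>With at most one color every class is the whole vertex set, which \<open>\<psi>\<close> preserves.\<close>
  have "d \<ge> 2" if "distinguishing_coloring G d k" for d k
  proof (rule ccontr)
    assume "\<not> d \<ge> 2"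
    have all: "k x < d" if "x \<in> verts G" for x
      using \<open>distinguishing_coloring G d k\<close> that by (simp add: distinguishing_coloring_def)
    have "\<psi> permutes verts G" using symmetric by (simp add: automorphism_def)
    moreover have "color_class G k q = verts G" if "q < d" for q
      using all that \<open>\<not> d \<ge> 2\<close> by (fastforce simp: color_class_def)
    ultimately have "\<forall>q<d. \<psi> ` color_class G k q = color_class G k q"
      by (simp add: permutes_image)
    then show False
      using \<open>distinguishing_coloring G d k\<close> symmetric by (auto simp: distinguishing_coloring_def)
  qed
  then show "Dist G = 2"
    unfolding Dist_def using c by (intro Least_equality) auto
  have "card W \<le> card (color_class G k q)"
    if k: "distinguishing_coloring G 2 k" and "q < 2" for k q
  proof (rule min)
    show "determining_set G (color_class G k q)"
      unfolding determining_set_def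
    proof (intro conjI allI impI)
      fix \<phi> assume \<phi>: "automorphism G \<phi> \<and> (\<forall>w\<in>color_class G k q. \<phi> w = w)"
      then have perm: "\<phi> permutes verts G" by (simp add: automorphism_def)
      have q: "\<phi> ` color_class G k q = color_class G k q"
        using \<phi> by force
      \<comment> \<open>The other class is the complement, so it is preserved as well.\<close>
      have "color_class G k r = verts G - color_class G k q" if "r < 2" "r \<noteq> q" for r
        using k that \<open>q < 2\<close>
        by (fastforce simp: color_class_def distinguishing_coloring_def less_2_cases_iff)
      then have "\<phi> ` color_class G k r = color_class G k r" if "r < 2" for r
        using q that perm
        by (cases "r = q") (simp_all add: image_set_diff permutes_inj permutes_image)
      then show "\<phi> = id"
        using k \<phi> by (simp add: distinguishing_coloring_def)
    qed (simp add: color_class_def)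
  qed
  then show "cost G = card W"
    unfolding cost_def using c class0 fin W
    by (intro Least_equality exI[of _ c] exI[of _ 0]) (auto intro: finite_subset)
qed

lemma card_determining_set_ge_2:
  assumes fin: "finite (verts G)"
    and ne: "verts G \<noteq> {}"
    and fixing: "\<And>x. x \<in> verts G \<Longrightarrow> \<exists>\<phi>. automorphism G \<phi> \<and> \<phi> x = x \<and> \<phi> \<noteq> id"
    and S: "determining_set G S"
  shows "2 \<le> card S"
proof (rule ccontr)
  assume "\<not> 2 \<le> card S"
  then consider "card S = 0" | "card S = 1" by linarith
  moreover have "finite S" "S \<subseteq> verts G"
    using S fin by (auto simp: determining_set_def intro: finite_subset)
  ultimately obtain x where "x \<in> verts G" "S \<subseteq> {x}"
    using ne by (cases) (auto simp: card_1_singleton_iff)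
  then show False
    using fixing S by (fastforce simp: determining_set_def)
qed


section \<open>Integer functions with steps of constant length\<close>

lemma periodic_multiple:
  fixes h :: "int \<Rightarrow> 'b" and s :: int
  assumes "\<And>a. h (a + s) = h a"
  shows "h (a + x * s) = h a"
proof (induction x rule: int_induct[where k = 0])
  case (step1 x)
  then show ?case using assms[of "a + x * s"] by (simp add: algebra_simps)
next
  case (step2 x)
  then show ?case using assms[of "a + (x - 1) * s"] by (simp add: algebra_simps)
qed simp

lemma step_multiple:
  fixes f e :: "int \<Rightarrow> int" and n s :: int
  assumes step: "\<And>a. n dvd f (a + s) - f a - e a * s" and e: "\<And>a. e (a + s) = e a"
  shows "n dvd f (a + x * s) - f a - e a * x * s"
proof (induction x rule: int_induct[where k = 0])
  case (step1 x)
  have "f (a + (x + 1) * s) - f a - e a * (x + 1) * s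
      = (f (a + x * s + s) - f (a + x * s) - e (a + x * s) * s) + (f (a + x * s) - f a - e a * x * s)"
    using periodic_multiple[of e s a x] e by (simp add: algebra_simps)
  then show ?case using step1 step by (metis dvd_add)
next
  case (step2 x)
  have "f (a + (x - 1) * s) - f a - e a * (x - 1) * s
      = (f (a + x * s) - f a - e a * x * s)
        - (f (a + (x - 1) * s + s) - f (a + (x - 1) * s) - e (a + (x - 1) * s) * s)"
    using periodic_multiple[of e s a "x - 1"] e by (simp add: algebra_simps)
  then show ?case using step2 step by (metis dvd_diff)
qed simp

text \<open>
  If the sign changed between two consecutive steps, the second step would undo the first, giving
  \<open>f (a + 2 s) \<equiv> f a\<close> against injectivity.
\<close>
lemma sign_constant:
  fixes f :: "int \<Rightarrow> int" and n s :: int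
  assumes inj: "\<And>a b. n dvd f a - f b \<Longrightarrow> n dvd a - b"
    and step: "\<And>a. n dvd f (a + s) - f a - s \<or> n dvd f (a + s) - f a + s"
    and s: "\<not> n dvd 2 * s"
  obtains e :: "int \<Rightarrow> int"
  where "\<And>a. e a = 1 \<or> e a = -1" "\<And>a. n dvd f (a + s) - f a - e a * s" "\<And>a. e (a + s) = e a"
proof -
  define e :: "int \<Rightarrow> int" where "e a = (if n dvd f (a + s) - f a - s then 1 else -1)" for a
  have e1: "e a = 1 \<or> e a = -1" for a by (simp add: e_def)
  have e2: "n dvd f (a + s) - f a - e a * s" for a using step[of a] by (cases "n dvd f (a + s) - f a - s") (simp_all add: e_def)
  have "e (a + s) = e a" for a
  proof (rule ccontr)
    assume "e (a + s) \<noteq> e a"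
    then have "e (a + s) = - e a" using e1[of a] e1[of "a + s"] by auto
    then have "f (a + s + s) - f a
        = (f (a + s + s) - f (a + s) - e (a + s) * s) + (f (a + s) - f a - e a * s)"
      by simp
    then have "n dvd f (a + s + s) - f a" using e2 by (metis dvd_add)
    then have "n dvd (a + s + s) - a" by (rule inj)
    then show False using s by simp
  qed
  with e1 e2 show thesis by (rule that)
qed


section \<open>Adjacency in the subdivided circulant graph\<close>

locale subdivided_circulant_graph =
  fixes n i j :: int and p :: nat
  assumes i_pos: "0 < i" and i_less_j: "i < j" and j_less: "2 * j < n"
    and gcd_1: "gcd n (gcd i j) = 1"
    and p_pos: "p \<ge> 1"
begin

abbreviation "G \<equiv> subdivided_circulant n i j p"

text \<open>
  Indices are taken to be arbitrary integers and reduced here, so that later arguments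
  compute with congruences instead of remainders.
\<close>
definition u :: "int \<Rightarrow> scvertex" where
  "u a = U (a mod n)"

definition path :: "int \<Rightarrow> nat \<Rightarrow> scvertex" where
  "path a r = sub_path n j p (a mod n) r"

definition nbrs :: "scvertex \<Rightarrow> scvertex set" where
  "nbrs x = {y. {x, y} \<in> edges G}"

lemma n_gt_4: "n > 4"
  using i_pos i_less_j j_less by linarith

lemma dvd_small_iff: "\<bar>a\<bar> < n \<Longrightarrow> n dvd a \<longleftrightarrow> a = 0"
  by (metis abs_0 dvd_0_right dvd_abs_iff zdvd_not_zless zero_less_abs_iff)

lemma connections_not_dvd: "\<not> n dvd i" "\<not> n dvd j" "\<not> n dvd 2 * i" "\<not> n dvd 2 * j"
  using i_pos i_less_j j_less by (auto simp: dvd_small_iff)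

lemma u_eq_iff: "u a = u b \<longleftrightarrow> n dvd a - b"
  by (simp add: u_def mod_eq_dvd_iff)

lemma path_0 [simp]: "path a 0 = u a"
  by (simp add: path_def sub_path_def u_def)

lemma path_end [simp]: "path a (Suc p) = u (a + j)"
  by (simp add: path_def sub_path_def u_def mod_add_left_eq)

lemma path_inner: "1 \<le> r \<Longrightarrow> r \<le> p \<Longrightarrow> path a r = V (a mod n) r"
  by (simp add: path_def sub_path_def)

lemma path_cong: "n dvd a - b \<Longrightarrow> path a r = path b r"
  unfolding path_def using mod_eq_dvd_iff by metis

lemma path_eq_iff:
  assumes "1 \<le> r" "r \<le> p" "1 \<le> s" "s \<le> p"
  shows "path a r = path b s \<longleftrightarrow> n dvd a - b \<and> r = s"
  using assms by (auto simp: path_inner mod_eq_dvd_iff)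

lemma path_ne_u:
  assumes "1 \<le> r" "r \<le> p"
  shows "path a r \<noteq> u b" "u b \<noteq> path a r"
  using assms by (auto simp: path_inner u_def)

lemma path_eq_u_iff:
  assumes "r \<le> Suc p"
  shows "path a r = u b \<longleftrightarrow> r = 0 \<and> n dvd a - b \<or> r = Suc p \<and> n dvd a + j - b"
proof -
  consider "r = 0" | "1 \<le> r" "r \<le> p" | "r = Suc p" using assms by linarith
  then show ?thesis by cases (auto simp: u_eq_iff path_ne_u)
qed

lemma carrier_iff: "a \<in> carrier (residue_ring n) \<longleftrightarrow> 0 \<le> a \<and> a < n"
  by (auto simp: residue_ring_def)

lemma mod_n_bounds: "0 \<le> a mod n" "a mod n < n"
  using n_gt_4 by auto

lemma Collect_carrier_eq: "{f a | a. a \<in> carrier (residue_ring n)} = range (\<lambda>a. f (a mod n))"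
proof (intro subset_antisym subsetI)
  fix x assume "x \<in> {f a | a. a \<in> carrier (residue_ring n)}"
  then obtain a where "x = f a" "a = a mod n" by (auto simp: carrier_iff)
  then show "x \<in> range (\<lambda>a. f (a mod n))" by (metis rangeI)
next
  fix x assume "x \<in> range (\<lambda>a. f (a mod n))"
  then show "x \<in> {f a | a. a \<in> carrier (residue_ring n)}"
    using mod_n_bounds by (auto simp: carrier_iff)
qed

lemma verts_eq: "verts G = range u \<union> {path a r | a r. 1 \<le> r \<and> r \<le> p}"
proof -
  have "{U a | a. a \<in> carrier (residue_ring n)} = range u"
    by (subst Collect_carrier_eq) (auto simp: u_def)
  moreover have "{V a r | a r. a \<in> carrier (residue_ring n) \<and> 1 \<le> r \<and> r \<le> p}
      = (\<Union>r\<in>{1..p}. {V a r | a. a \<in> carrier (residue_ring n)})"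
    by auto
  moreover have "\<dots> = (\<Union>r\<in>{1..p}. range (\<lambda>a. path a r))"
    by (rule SUP_cong[OF refl], subst Collect_carrier_eq) (simp add: path_inner)
  moreover have "\<dots> = {path a r | a r. 1 \<le> r \<and> r \<le> p}"
    by auto blast
  ultimately show ?thesis
    by (simp add: subdivided_circulant_def)
qed

lemma finite_verts: "finite (verts G)"
proof -
  have "verts G \<subseteq> U ` {0..<n} \<union> case_prod V ` ({0..<n} \<times> {1..p})"
    by (auto simp: subdivided_circulant_def carrier_iff)
  then show ?thesis by (rule finite_subset) auto
qed

lemma u_in_verts [simp]: "u a \<in> verts G"
  by (simp add: verts_eq)

lemma path_in_verts [simp]: "r \<le> Suc p \<Longrightarrow> path a r \<in> verts G"
proof -
  assume "r \<le> Suc p"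
  then consider "r = 0" | "1 \<le> r" "r \<le> p" | "r = Suc p" by linarith
  then show ?thesis by cases (auto simp: verts_eq)
qed

lemma vert_cases:
  assumes "x \<in> verts G"
  obtains a where "x = u a" | a r where "x = path a r" "1 \<le> r" "r \<le> p"
  using assms by (auto simp: verts_eq)

lemma vert_cases_path:
  assumes "x \<in> verts G"
  obtains a r where "x = path a r" "r \<le> p"
  using assms by (metis path_0 vert_cases le0)

lemma edges_eq:
  "edges G = {{u a, u (a + i)} | a. True} \<union> {{path a r, path a (Suc r)} | a r. r \<le> p}"
proof -
  have "{{U a, U ((a + i) mod n)} | a. a \<in> carrier (residue_ring n)} = {{u a, u (a + i)} | a. True}"
    by (subst Collect_carrier_eq) (auto simp: u_def mod_add_left_eq)
  moreover have "{{sub_path n j p a r, sub_path n j p a (r + 1)} | a r.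
                 a \<in> carrier (residue_ring n) \<and> r \<le> p}
      = (\<Union>r\<in>{..p}. {{sub_path n j p a r, sub_path n j p a (r + 1)} | a. a \<in> carrier (residue_ring n)})"
    by blast
  moreover have "\<dots> = {{path a r, path a (Suc r)} | a r. r \<le> p}"
    by (subst Collect_carrier_eq) (auto simp: path_def)
  ultimately show ?thesis by (simp add: subdivided_circulant_def)
qed

lemma nbrs_u: "nbrs (u a) = {u (a + i), u (a - i), path a 1, path (a - j) p}"
proof (intro Set.set_eqI iffI)
  fix y assume "y \<in> nbrs (u a)"
  then consider b where "{u a, y} = {u b, u (b + i)}"
    | b r where "{u a, y} = {path b r, path b (Suc r)}" "r \<le> p"
    by (auto simp: nbrs_def edges_eq)
  then show "y \<in> {u (a + i), u (a - i), path a 1, path (a - j) p}"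
  proof cases
    case 1
    then consider "u a = u b" "y = u (b + i)" | "u a = u (b + i)" "y = u b"
      by (auto simp: doubleton_eq_iff)
    then show ?thesis
    proof cases
      case 1
      then have "y = u (a + i)" by (simp add: u_eq_iff dvd_diff_commute)
      then show ?thesis by simp
    next
      case 2
      then have "y = u (a - i)" by (simp add: u_eq_iff dvd_diff_commute algebra_simps)
      then show ?thesis by simp
    qed
  next
    case 2
    then consider "path b r = u a" "y = path b (Suc r)" | "path b (Suc r) = u a" "y = path b r"
      by (auto simp: doubleton_eq_iff)
    then show ?thesis
    proof cases
      case 1
      then have "r = 0" "n dvd b - a" using \<open>r \<le> p\<close> by (auto simp: path_eq_u_iff)
      then have "y = path a 1" using 1 path_cong by simp
      then show ?thesis by simp
    next
      case 3: 2
      then have "r = p" "n dvd b + j - a" using \<open>r \<le> p\<close> path_eq_u_iff[of "Suc r" b a] by auto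
      then have "y = path (a - j) p" using 3 path_cong[of b "a - j"] by (simp add: algebra_simps)
      then show ?thesis by simp
    qed
  qed
next
  fix y assume "y \<in> {u (a + i), u (a - i), path a 1, path (a - j) p}"
  then consider "y = u (a + i)" | "y = u (a - i)" | "y = path a 1" | "y = path (a - j) p" by blast
  then show "y \<in> nbrs (u a)"
  proof cases
    case 1
    then show ?thesis by (auto simp: nbrs_def edges_eq)
  next
    case 2
    then have "{u a, y} = {u (a - i), u (a - i + i)}" by auto
    then show ?thesis unfolding nbrs_def edges_eq by blast
  next
    case 3
    then have "{u a, y} = {path a 0, path a (Suc 0)}" by simp
    then show ?thesis unfolding nbrs_def edges_eq by blast
  next
    case 4
    then have "{u a, y} = {path (a - j) p, path (a - j) (Suc p)}" by auto
    then show ?thesis unfolding nbrs_def edges_eq by blast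
  qed
qed

lemma nbrs_path:
  assumes r: "1 \<le> r" "r \<le> p"
  shows "nbrs (path a r) = {path a (r - 1), path a (Suc r)}"
proof (intro Set.set_eqI iffI)
  fix y assume "y \<in> nbrs (path a r)"
  then obtain b s where s: "{path a r, y} = {path b s, path b (Suc s)}" "s \<le> p"
    using path_ne_u[OF r] by (auto simp: nbrs_def edges_eq doubleton_eq_iff)
  then consider "path a r = path b s" "y = path b (Suc s)" | "path a r = path b (Suc s)" "y = path b s"
    by (auto simp: doubleton_eq_iff)
  then show "y \<in> {path a (r - 1), path a (Suc r)}"
  proof cases
    case 1
    then have "s \<noteq> 0" using path_ne_u[OF r] by (intro notI) auto
    then have "s = r" "n dvd a - b" using 1 s r path_eq_iff[of r s a b] by auto
    then show ?thesis using 1 path_cong by auto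
  next
    case 2
    then have "s \<noteq> p" using path_ne_u[OF r] by (intro notI) auto
    then have "r = Suc s" "n dvd a - b" using 2 s r path_eq_iff[of r "Suc s" a b] by auto
    then show ?thesis using 2 path_cong by auto
  qed
next
  fix y assume "y \<in> {path a (r - 1), path a (Suc r)}"
  moreover have "{path a r, path a (r - 1)} = {path a (r - 1), path a (Suc (r - 1))}"
    using r by auto
  ultimately show "y \<in> nbrs (path a r)"
    using r unfolding nbrs_def edges_eq by fastforce
qed


section \<open>The action of an automorphism\<close>

lemma automorphism_inj:
  "automorphism G \<phi> \<Longrightarrow> \<phi> x = \<phi> y \<longleftrightarrow> x = y"
  by (metis automorphism_def permutes_inj injD)

lemma automorphism_vert:
  "automorphism G \<phi> \<Longrightarrow> x \<in> verts G \<Longrightarrow> \<phi> x \<in> verts G"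
  by (simp add: automorphism_def permutes_in_image)

lemma nbrs_subset_verts: "x \<in> verts G \<Longrightarrow> nbrs x \<subseteq> verts G"
proof -
  assume "x \<in> verts G"
  then show "nbrs x \<subseteq> verts G"
  proof (cases rule: vert_cases)
    case (1 a)
    then show ?thesis using p_pos by (simp add: nbrs_u)
  next
    case (2 a r)
    then show ?thesis by (simp add: nbrs_path)
  qed
qed

lemma automorphism_nbrs:
  assumes "automorphism G \<phi>" "x \<in> verts G"
  shows "nbrs (\<phi> x) = \<phi> ` nbrs x"
proof -
  have perm: "\<phi> ` verts G = verts G"
    using assms by (simp add: automorphism_def permutes_image)
  have iff: "\<phi> y \<in> nbrs (\<phi> x) \<longleftrightarrow> y \<in> nbrs x" if "y \<in> verts G" for y
    using assms that by (simp add: automorphism_def nbrs_def)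
  show ?thesis
  proof (intro Set.set_eqI iffI)
    fix y assume y: "y \<in> nbrs (\<phi> x)"
    then have "y \<in> \<phi> ` verts G"
      using nbrs_subset_verts[OF automorphism_vert[OF assms]] perm by auto
    then show "y \<in> \<phi> ` nbrs x" using y iff by auto
  next
    fix y assume "y \<in> \<phi> ` nbrs x"
    then show "y \<in> nbrs (\<phi> x)" using iff nbrs_subset_verts[OF assms(2)] by auto
  qed
qed

lemma automorphism_card_nbrs:
  assumes "automorphism G \<phi>" "x \<in> verts G"
  shows "card (nbrs (\<phi> x)) = card (nbrs x)"
proof -
  have "inj_on \<phi> (nbrs x)"
    using assms(1) by (meson automorphism_inj inj_onI)
  then show ?thesis
    by (simp add: automorphism_nbrs[OF assms] card_image)
qed

lemma card_nbrs_u: "3 \<le> card (nbrs (u a))"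
proof -
  have "a + i - (a - i) = 2 * i" by simp
  then have ne: "u (a + i) \<noteq> u (a - i)" using connections_not_dvd(3) u_eq_iff by metis
  have ne': "path a 1 \<noteq> u b" for b by (rule path_ne_u(1)) (use p_pos in auto)
  have "card {path a 1, u (a + i), u (a - i)} = 3"
    using ne ne'[of "a + i"] ne'[of "a - i"] card_3_iff by blast
  moreover have "card {path a 1, u (a + i), u (a - i)} \<le> card (nbrs (u a))"
    unfolding nbrs_u by (intro card_mono) blast+
  ultimately show ?thesis by linarith
qed

text \<open>The degree separates the branch vertices \<open>u\<^sub>a\<close> from the subdividing vertices.\<close>
lemma automorphism_u:
  assumes \<phi>: "automorphism G \<phi>"
  obtains b where "\<phi> (u a) = u b"
proof -
  have "\<phi> (u a) \<in> verts G" using \<phi> by (simp add: automorphism_vert)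
  then show thesis
  proof (cases rule: vert_cases)
    case (2 b r)
    have "3 \<le> card (nbrs (u a))" by (rule card_nbrs_u)
    also have "\<dots> = card (nbrs (\<phi> (u a)))"
      using automorphism_card_nbrs[OF \<phi>, of "u a"] by simp
    also have "\<dots> \<le> 2"
      using 2 by (simp add: nbrs_path card_insert_if)
    finally show thesis by simp
  qed (use that in blast)
qed

lemma automorphism_inner:
  assumes \<phi>: "automorphism G \<phi>" and r: "1 \<le> r" "r \<le> p"
  shows "\<phi> (path a r) \<noteq> u b"
proof
  assume *: "\<phi> (path a r) = u b"
  have "3 \<le> card (nbrs (u b))" by (rule card_nbrs_u)
  also have "\<dots> = card (nbrs (path a r))"
    using automorphism_card_nbrs[OF \<phi>, of "path a r"] r * by simp
  also have "\<dots> \<le> 2" using r by (simp add: nbrs_path card_insert_if)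
  finally show False by simp
qed

text \<open>
  A path whose inner vertices have degree two can only be continued in one way, so the image of a
  subdivided path agrees with any such path \<open>q\<close> with which it shares its first edge.
\<close>
lemma automorphism_walk:
  assumes \<phi>: "automorphism G \<phi>"
    and q: "\<And>r. 1 \<le> r \<Longrightarrow> r \<le> p \<Longrightarrow> nbrs (q r) = {q (r - 1), q (Suc r)}"
    and start: "\<phi> (path a 0) = q 0" "\<phi> (path a 1) = q 1"
    and "r \<le> Suc p"
  shows "\<phi> (path a r) = q r"
  using \<open>r \<le> Suc p\<close>
proof (induction r rule: less_induct)
  case (less r)
  show ?case
  proof (cases "r \<le> 1")
    case True
    then show ?thesis using start by (cases "r = 0") (auto simp: le_Suc_eq)
  next
    case False
    then obtain s where s: "r = Suc s" "1 \<le> s" "s \<le> p"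
      using less.prems by (intro that[of "r - 1"]) auto
    have "path a (Suc s) \<in> nbrs (path a s)" using s by (simp add: nbrs_path)
    then have "\<phi> (path a (Suc s)) \<in> nbrs (q s)"
      using automorphism_nbrs[OF \<phi>, of "path a s"] less.IH[of s] s by auto
    moreover have "path a (Suc s) \<noteq> path a (s - 1)"
    proof (cases "s = 1")
      case True
      then show ?thesis using path_eq_u_iff[of "Suc s" a a] connections_not_dvd(2) s by simp
    next
      case False
      then have "1 \<le> s - 1" "s - 1 \<le> p" using s by auto
      then show ?thesis
        using s path_eq_iff[of "Suc s" "s - 1"] path_ne_u[of "s - 1"] by (cases "s = p") auto
    qed
    then have "\<phi> (path a (Suc s)) \<noteq> q (s - 1)"
      using less.IH[of "s - 1"] s automorphism_inj[OF \<phi>] by (metis diff_le_self le_SucI le_imp_less_Suc le_trans)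
    ultimately show ?thesis using q s by auto
  qed
qed

text \<open>
  Only two edges at \<open>u\<^sub>b\<close> lead to subdividing vertices: one starts the path to \<open>b + j\<close>, the
  other runs backwards along the path from \<open>b - j\<close>.
\<close>
lemma automorphism_path:
  assumes \<phi>: "automorphism G \<phi>" and b: "\<phi> (u a) = u b"
  shows "(\<forall>r\<le>Suc p. \<phi> (path a r) = path b r) \<or>
         (\<forall>r\<le>Suc p. \<phi> (path a r) = path (b - j) (Suc p - r))"
proof -
  have "path a 1 \<in> nbrs (u a)" by (simp add: nbrs_u)
  then have "\<phi> (path a 1) \<in> nbrs (u b)"
    using automorphism_nbrs[OF \<phi>, of "u a"] b by simp
  then consider "\<phi> (path a 1) = path b 1" | "\<phi> (path a 1) = path (b - j) p"
    using automorphism_inner[OF \<phi>, of 1] p_pos by (auto simp: nbrs_u)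
  then show ?thesis
  proof cases
    case 1
    then have "\<phi> (path a r) = path b r" if "r \<le> Suc p" for r
      using automorphism_walk[OF \<phi>, of "path b"] nbrs_path b that by simp
    then show ?thesis by blast
  next
    case 2
    have "nbrs (path (b - j) (Suc p - r)) = {path (b - j) (Suc p - (r - 1)), path (b - j) (Suc p - Suc r)}"
      if "1 \<le> r" "r \<le> p" for r
      using that nbrs_path[of "Suc p - r" "b - j"] by (auto simp: Suc_diff_le)
    then have "\<phi> (path a r) = path (b - j) (Suc p - r)" if "r \<le> Suc p" for r
      using automorphism_walk[OF \<phi>, of "\<lambda>r. path (b - j) (Suc p - r)"] b 2 that by simp
    then show ?thesis by blast
  qed
qed

text \<open>
  If the path from \<open>a\<close> to \<open>a + j\<close> were not fixed, it would be sent to the path that leaves \<open>u\<^sub>a\<close> in the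
  other direction, and its end would move to index \<open>a - j\<close>.
\<close>
lemma automorphism_id:
  assumes \<phi>: "automorphism G \<phi>" and u: "\<And>a. \<phi> (u a) = u a"
  shows "\<phi> = id"
proof
  fix x
  show "\<phi> x = id x"
  proof (cases "x \<in> verts G")
    case True
    then obtain a r where x: "x = path a r" "r \<le> p" by (rule vert_cases_path)
    have "\<phi> (path a (Suc p)) \<noteq> path (a - j) (Suc p - Suc p)"
      using connections_not_dvd u[of "a + j"] by (simp add: u_eq_iff)
    then show ?thesis using automorphism_path[OF \<phi> u, of a] x by auto
  next
    case False
    then show ?thesis using \<phi> by (auto simp: automorphism_def dest: permutes_not_in)
  qed
qed

section \<open>Automorphisms are affine on the branch vertices\<close>

lemma small_sums_not_dvd: "\<not> n dvd 2 * (j - i)" "2 * (i + j) \<noteq> n \<Longrightarrow> \<not> n dvd 2 * (i + j)"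
proof -
  show "\<not> n dvd 2 * (j - i)"
    using i_pos i_less_j j_less by (subst dvd_small_iff) auto
  assume "2 * (i + j) \<noteq> n"
  then have "\<not> n dvd 2 * (i + j) - n"
    using i_pos i_less_j j_less by (subst dvd_small_iff) auto
  then show "\<not> n dvd 2 * (i + j)"
    by (metis dvd_diff dvd_refl)
qed

lemma bezout: obtains x y z where "x * n + y * i + z * j = 1"
proof -
  obtain y z where yz: "y * i + z * j = gcd i j" by (metis bezout_int)
  obtain x w where "x * n + w * gcd i j = 1" using gcd_1 by (metis bezout_int)
  then have "x * n + (w * y) * i + (w * z) * j = 1"
    by (simp add: yz[symmetric] algebra_simps)
  then show thesis by (rule that)
qed

lemma dvd_cancel_connections:
  assumes "n dvd k * i" "n dvd k * j"
  shows "n dvd k"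
proof -
  obtain x y z where "x * n + y * i + z * j = 1" by (rule bezout)
  then have "k = k * (x * n + y * i + z * j)" by simp
  also have "\<dots> = k * x * n + y * (k * i) + z * (k * j)" by (simp add: algebra_simps)
  finally show ?thesis using assms by (metis dvd_add dvd_mult dvd_refl)
qed

text \<open>Membership in \<open>H'\<close>, for an arbitrary representative of a residue class.\<close>
definition preserves_connections :: "int \<Rightarrow> bool" where
  "preserves_connections t \<longleftrightarrow>
     (n dvd t * i - i \<or> n dvd t * i + i) \<and> (n dvd t * j - j \<or> n dvd t * j + j)"

lemma preserves_connections_minus_1: "preserves_connections (- 1)"
  by (simp add: preserves_connections_def)

lemma preserves_connections_uminus:
  "preserves_connections t \<Longrightarrow> preserves_connections (- t)"
proof -
  have "- t * x - x = - (t * x + x)" "- t * x + x = - (t * x - x)" for x by simp_all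
  then have "n dvd - t * x - x \<longleftrightarrow> n dvd t * x + x" "n dvd - t * x + x \<longleftrightarrow> n dvd t * x - x" for x
    by (metis dvd_minus_iff)+
  then show "preserves_connections t \<Longrightarrow> preserves_connections (- t)"
    unfolding preserves_connections_def by blast
qed

text \<open>
  Both \<open>i\<close> and \<open>j\<close> are fixed by \<open>t\<^sup>2\<close>, and together they generate \<open>\<int>\<^sub>n\<close>. So such a \<open>t\<close> is its own
  inverse, and in particular a unit.
\<close>
lemma preserves_connections_square:
  assumes "preserves_connections t"
  shows "n dvd t * t - 1"
proof (rule dvd_cancel_connections)
  have *: "n dvd (t * t - 1) * x" if "n dvd t * x - x \<or> n dvd t * x + x" for x
  proof -
    have "(t * t - 1) * x = (t + 1) * (t * x - x)" "(t * t - 1) * x = (t - 1) * (t * x + x)"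
      by (simp_all add: algebra_simps)
    then show ?thesis using that by (metis dvd_mult)
  qed
  show "n dvd (t * t - 1) * i" "n dvd (t * t - 1) * j"
    using assms * by (auto simp: preserves_connections_def)
qed

text \<open>
  With \<open>e\<close> and \<open>d\<close> the signs of the steps by \<open>i\<close> and by \<open>j\<close>, closing the parallelogram
  \<open>a, a + i, a + i + j, a + j\<close> gives \<open>(e a - e (a + j)) i + (d (a + i) - d a) j \<equiv> 0\<close>, where both
  differences are \<open>0\<close> or \<open>\<plusminus>2\<close>. Of the values \<open>2 j\<close>, \<open>2 (j - i)\<close> and \<open>2 (i + j)\<close> only the last can
  be a multiple of \<open>n\<close>, so otherwise \<open>d\<close> is invariant under \<open>i\<close>. Every residue is of the form
  \<open>x i + y j\<close>, reached from \<open>0\<close> by steps by \<open>i\<close> of sign \<open>e 0\<close> and then steps by \<open>j\<close> of sign \<open>d 0\<close>.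
  For \<open>i = 1\<close>, steps by \<open>i\<close> alone reach every residue, and no parallelogram is needed.
\<close>
lemma affine_of_steps:
  fixes f :: "int \<Rightarrow> int"
  assumes f: "\<And>a b. n dvd f a - f b \<longleftrightarrow> n dvd a - b"
    and step_i: "\<And>a. n dvd f (a + i) - f a - i \<or> n dvd f (a + i) - f a + i"
    and step_j: "\<And>a. n dvd f (a + j) - f a - j \<or> n dvd f (a + j) - f a + j"
    and connections: "i = 1 \<or> 2 * (i + j) \<noteq> n"
  obtains t where "preserves_connections t" "\<And>a. n dvd f a - (f 0 + t * a)"
proof -
  obtain e where e: "\<And>a. e a = 1 \<or> e a = -1" "\<And>a. n dvd f (a + i) - f a - e a * i" "\<And>a. e (a + i) = e a"
    using sign_constant[of n f i] f step_i connections_not_dvd by metis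
  obtain d where d: "\<And>a. d a = 1 \<or> d a = -1" "\<And>a. n dvd f (a + j) - f a - d a * j" "\<And>a. d (a + j) = d a"
    using sign_constant[of n f j] f step_j connections_not_dvd by metis
  have e_walk: "n dvd f (0 + x * i) - f 0 - e 0 * x * i" for x
    using e by (intro step_multiple)
  have "\<exists>t. \<forall>a. n dvd f a - (f 0 + t * a)"
  proof (cases "i = 1")
    case True
    then have "n dvd f a - (f 0 + e 0 * a)" for a
      using e_walk[of a] by (simp add: algebra_simps)
    then show ?thesis by blast
  next
    case False
    then have sum: "\<not> n dvd 2 * (i + j)" using connections small_sums_not_dvd by blast
    have d_i: "d (a + i) = d a" for a
    proof (rule ccontr)
      assume "d (a + i) \<noteq> d a"
      then have d': "d (a + i) = - d a" using d(1)[of a] d(1)[of "a + i"] by auto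
      \<comment> \<open>The difference of the two ways from \<open>f a\<close> to \<open>f (a + i + j)\<close>.\<close>
      have "n dvd ((f (a + j) - f a - d a * j) + (f (a + j + i) - f (a + j) - e (a + j) * i))
          - ((f (a + i) - f a - e a * i) + (f (a + i + j) - f (a + i) - d (a + i) * j))"
        by (intro dvd_diff dvd_add e d)
      also have "\<dots> = (e a - e (a + j)) * i - 2 * d a * j"
        by (simp add: d' algebra_simps)
      finally have X: "n dvd (e a - e (a + j)) * i - 2 * d a * j" .
      have neg: "\<not> n dvd - (2 * j)" "\<not> n dvd - (2 * (i + j))" "\<not> n dvd - (2 * (j - i))"
        using sum connections_not_dvd small_sums_not_dvd by (simp_all only: dvd_minus_iff not_False_eq_True)
      have forms: "2 * i - 2 * j = - (2 * (j - i))" "2 * i + 2 * j = 2 * (i + j)"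
        "- 2 * i - 2 * j = - (2 * (i + j))" "- 2 * i + 2 * j = 2 * (j - i)"
        by simp_all
      from e(1)[of a] e(1)[of "a + j"] d(1)[of a] show False
        using X neg forms sum connections_not_dvd(4) small_sums_not_dvd(1)
        by (elim disjE) (simp_all add: algebra_simps)
    qed
    obtain x y z where xyz: "x * n + y * i + z * j = 1" by (rule bezout)
    \<comment> \<open>The slope is the value of the candidate linear part at \<open>1 \<equiv> y i + z j\<close>.\<close>
    have "n dvd f a - (f 0 + (e 0 * y * i + d 0 * z * j) * a)" for a
    proof -
      define b where "b = 0 + (a * y) * i"
      have "n dvd f (b + (a * z) * j) - f b - d b * (a * z) * j"
        using d by (intro step_multiple)
      moreover have "d b = d 0"
        unfolding b_def using d_i by (rule periodic_multiple)
      ultimately have 1: "n dvd f (b + (a * z) * j) - f b - d 0 * (a * z) * j" by simp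
      have 2: "n dvd f b - f 0 - e 0 * (a * y) * i"
        unfolding b_def by (rule e_walk)
      have "a - (b + (a * z) * j) = a * (x * n + y * i + z * j) - (b + (a * z) * j)"
        by (simp add: xyz)
      also have "\<dots> = n * (a * x)" by (simp add: b_def algebra_simps)
      finally have 3: "n dvd f a - f (b + (a * z) * j)" by (simp add: f)
      have "f a - (f 0 + (e 0 * y * i + d 0 * z * j) * a)
          = (f a - f (b + (a * z) * j)) + (f (b + (a * z) * j) - f b - d 0 * (a * z) * j)
            + (f b - f 0 - e 0 * (a * y) * i)"
        by (simp add: algebra_simps)
      then show ?thesis using 1 2 3 by (metis dvd_add)
    qed
    then show ?thesis by blast
  qed
  then obtain t where t: "\<And>a. n dvd f a - (f 0 + t * a)" by blast
  have "n dvd t * s - s \<or> n dvd t * s + s"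
    if "n dvd f (0 + s) - f 0 - s \<or> n dvd f (0 + s) - f 0 + s" for s
  proof -
    have "t * s - s = (f (0 + s) - f 0 - s) - (f s - (f 0 + t * s))"
      "t * s + s = (f (0 + s) - f 0 + s) - (f s - (f 0 + t * s))" by simp_all
    then show ?thesis using that t by (metis dvd_diff)
  qed
  then have "preserves_connections t"
    using step_i step_j unfolding preserves_connections_def by blast
  then show thesis using t by (rule that)
qed

lemma automorphism_affine:
  assumes \<phi>: "automorphism G \<phi>" and connections: "i = 1 \<or> 2 * (i + j) \<noteq> n"
  obtains c t where "preserves_connections t" "\<And>a. \<phi> (u a) = u (c + t * a)"
proof -
  have "\<forall>a. \<exists>b. \<phi> (u a) = u b" using automorphism_u[OF \<phi>] by metis
  then obtain f where f: "\<And>a. \<phi> (u a) = u (f a)" by metis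
  have iff: "n dvd f a - f b \<longleftrightarrow> n dvd a - b" for a b
    using automorphism_inj[OF \<phi>, of "u a" "u b"] by (simp add: f u_eq_iff)
  have step_i: "n dvd f (a + i) - f a - i \<or> n dvd f (a + i) - f a + i" for a
  proof -
    have "u (a + i) \<in> nbrs (u a)" by (simp add: nbrs_u)
    then have "u (f (a + i)) \<in> nbrs (u (f a))"
      using automorphism_nbrs[OF \<phi>, of "u a"] f by (metis image_eqI u_in_verts)
    then have "u (f (a + i)) = u (f a + i) \<or> u (f (a + i)) = u (f a - i)"
      using path_ne_u p_pos by (auto simp: nbrs_u)
    then show ?thesis by (simp add: u_eq_iff algebra_simps)
  qed
  have step_j: "n dvd f (a + j) - f a - j \<or> n dvd f (a + j) - f a + j" for a
  proof -
    have "u (f (a + j)) = u (f a + j) \<or> u (f (a + j)) = u (f a - j)"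
      using automorphism_path[OF \<phi> f, of a] f[of "a + j"] by (auto dest: spec[of _ "Suc p"])
    then show ?thesis by (simp add: u_eq_iff algebra_simps)
  qed
  obtain t where "preserves_connections t" "\<And>a. n dvd f a - (f 0 + t * a)"
    using affine_of_steps[OF iff step_i step_j connections] by blast
  then show thesis using that[of t "f 0"] by (simp add: f u_eq_iff)
qed


section \<open>Affine involutions\<close>

text \<open>
  The extension of \<open>a \<mapsto> c + t a\<close> to the subdividing vertices. If \<open>t j \<equiv> j\<close>, directions of paths are
  kept. Otherwise \<open>t j \<equiv> - j\<close>, and the path from \<open>a\<close> to \<open>a + j\<close> is mapped onto the path with ends
  \<open>c + t a - j\<close> and \<open>c + t a\<close>, traversed backwards.
\<close>
definition affine_map :: "int \<Rightarrow> int \<Rightarrow> scvertex \<Rightarrow> scvertex" where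
  "affine_map c t x =
     (if x \<notin> verts G then x
      else case x of
        U a \<Rightarrow> u (c + t * a)
      | V a r \<Rightarrow> if n dvd t * j - j then path (c + t * a) r else path (c + t * a - j) (Suc p - r))"

lemma affine_mod_dvd: "n dvd c + t * (a mod n) - (c + t * a)"
proof -
  have "c + t * (a mod n) - (c + t * a) = n * (- t * (a div n))"
    by (simp add: minus_div_mult_eq_mod[symmetric] algebra_simps)
  then show ?thesis by simp
qed

lemma affine_map_u: "affine_map c t (u a) = u (c + t * a)"
proof -
  have "affine_map c t (u a) = u (c + t * (a mod n))"
    using u_in_verts[of a] by (simp add: affine_map_def u_def)
  then show ?thesis using affine_mod_dvd by (simp add: u_eq_iff)
qed

lemma affine_map_path:
  assumes t: "preserves_connections t" and r: "r \<le> Suc p"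
  shows "affine_map c t (path a r) =
    (if n dvd t * j - j then path (c + t * a) r else path (c + t * a - j) (Suc p - r))"
proof -
  consider "r = 0" | "1 \<le> r" "r \<le> p" | "r = Suc p" using r by linarith
  then show ?thesis
  proof cases
    case 1
    then show ?thesis by (simp add: affine_map_u)
  next
    case 2
    have "affine_map c t (path a r) =
        (if n dvd t * j - j then path (c + t * (a mod n)) r
         else path (c + t * (a mod n) - j) (Suc p - r))"
      using path_in_verts[OF r, of a] 2 by (simp add: affine_map_def path_inner)
    then show ?thesis
      using path_cong[of "c + t * (a mod n)" "c + t * a"]
        path_cong[of "c + t * (a mod n) - j" "c + t * a - j"] affine_mod_dvd[of c t a] by simp
  next
    case 3
    have "n dvd t * j + j" if "\<not> n dvd t * j - j"
      using t that by (simp add: preserves_connections_def)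
    then show ?thesis using 3 by (auto simp: affine_map_u u_eq_iff algebra_simps)
  qed
qed

text \<open>The condition on \<open>c\<close> says that \<open>a \<mapsto> c + t a\<close> is an involution, given \<open>t\<^sup>2 \<equiv> 1\<close>.\<close>
lemma automorphism_affine_map:
  assumes t: "preserves_connections t" and c: "n dvd c + t * c"
  shows "automorphism G (affine_map c t)"
proof (rule automorphism_of_involution)
  have fixed: "n dvd c + t * (c + t * a) - a" for a
  proof -
    have "c + t * (c + t * a) - a = (c + t * c) + (t * t - 1) * a" by (simp add: algebra_simps)
    then show ?thesis using c preserves_connections_square[OF t] by (metis dvd_add dvd_mult2)
  qed
  show "affine_map c t x \<in> verts G" if "x \<in> verts G" for x
    using that by (cases rule: vert_cases_path) (simp add: affine_map_path[OF t])
  show "affine_map c t x = x" if "x \<notin> verts G" for x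
    using that by (simp add: affine_map_def)
  show "affine_map c t (affine_map c t x) = x" if "x \<in> verts G" for x
    using that
  proof (cases rule: vert_cases_path)
    case (1 a r)
    show ?thesis
    proof (cases "n dvd t * j - j")
      case True
      then show ?thesis using 1 fixed by (simp add: affine_map_path[OF t] path_cong)
    next
      case False
      then have "n dvd t * j + j" using t by (simp add: preserves_connections_def)
      have "c + t * (c + t * a - j) - j - a = (c + t * (c + t * a) - a) - (t * j + j)"
        by (simp add: algebra_simps)
      then have "n dvd c + t * (c + t * a - j) - j - a"
        using fixed \<open>n dvd t * j + j\<close> by (metis dvd_diff)
      then show ?thesis using 1 False by (simp add: affine_map_path[OF t] path_cong)
    qed
  qed
  show "{affine_map c t x, affine_map c t y} \<in> edges G" if "{x, y} \<in> edges G" for x y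
  proof -
    from that consider a where "{x, y} = {u a, u (a + i)}"
      | a r where "{x, y} = {path a r, path a (Suc r)}" "r \<le> p"
      by (auto simp: edges_eq)
    then have "affine_map c t ` {x, y} \<in> edges G"
    proof cases
      case 1
      have "u (c + t * (a + i)) = u (c + t * a + i) \<or> u (c + t * (a + i)) = u (c + t * a - i)"
        using t by (simp add: preserves_connections_def u_eq_iff algebra_simps)
      then have "u (c + t * (a + i)) \<in> nbrs (u (c + t * a))"
        by (auto simp: nbrs_u)
      then show ?thesis by (simp add: 1 affine_map_u nbrs_def)
    next
      case 2
      show ?thesis
      proof (cases "n dvd t * j - j")
        case True
        then show ?thesis using 2 by (auto simp: affine_map_path[OF t] edges_eq simp del: path_end)
      next
        case False
        have "Suc p - r = Suc (p - r)" using 2 by simp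
        then have "affine_map c t ` {x, y}
            = {path (c + t * a - j) (p - r), path (c + t * a - j) (Suc (p - r))}"
          using 2 False by (simp add: affine_map_path[OF t] insert_commute del: path_end)
        then show ?thesis unfolding edges_eq by fastforce
      qed
    qed
    then show ?thesis by simp
  qed
qed

lemma affine_map_ne_id:
  assumes "\<not> n dvd t - 1"
  shows "affine_map c t \<noteq> id"
proof
  assume "affine_map c t = id"
  then have "u (c + t * 0) = u 0" "u (c + t * 1) = u 1" by (metis affine_map_u id_apply)+
  then have "n dvd c" "n dvd c + t - 1" by (simp_all add: u_eq_iff)
  then have "n dvd (c + t - 1) - c" by (rule dvd_diff[rotated])
  then show False using assms by simp
qed

lemma minus_1_not_cong_1: "\<not> n dvd - 1 - 1"
  using n_gt_4 by (simp add: dvd_small_iff)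

lemma reflection:
  "automorphism G (affine_map c (- 1))" "affine_map c (- 1) \<noteq> id"
  using preserves_connections_minus_1 minus_1_not_cong_1
  by (simp_all add: automorphism_affine_map affine_map_ne_id)

text \<open>
  The vertex \<open>u\<^sub>a\<close> is fixed by \<open>x \<mapsto> 2 a - x\<close>, and the only inner vertex of a path subdivided once is
  fixed by \<open>x \<mapsto> 2 a + j - x\<close>, which reverses the path. For longer paths there is a \<open>t\<close> different
  from \<open>\<plusminus>1\<close>; after replacing it by \<open>-t\<close> if necessary, \<open>t j \<equiv> j\<close>, and the
  map \<open>x \<mapsto> a + t (x - a)\<close> fixes the whole path from \<open>a\<close> to \<open>a + j\<close>.
\<close>
lemma nontrivial_fixing_vertex:
  assumes t: "\<not> (p \<ge> 2 \<and> (\<forall>t. preserves_connections t \<longrightarrow> n dvd t - 1 \<or> n dvd t + 1))"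
    and x: "x \<in> verts G"
  shows "\<exists>\<phi>. automorphism G \<phi> \<and> \<phi> x = x \<and> \<phi> \<noteq> id"
  using x
proof (cases rule: vert_cases)
  case (1 a)
  then have "affine_map (2 * a) (- 1) x = x" by (simp add: affine_map_u)
  then show ?thesis using reflection by blast
next
  case (2 a r)
  show ?thesis
  proof (cases "p \<ge> 2")
    case False
    then have "p = 1" "r = 1" using 2 by auto
    then have r: "r \<le> Suc p" "Suc p - r = r" by auto
    have "- 1 * j - j = - (2 * j)" by simp
    then have "\<not> n dvd - 1 * j - j" using connections_not_dvd(4) by (metis dvd_minus_iff)
    then have "affine_map (2 * a + j) (- 1) (path a r) = path (2 * a + j + - 1 * a - j) r"
      using affine_map_path[OF preserves_connections_minus_1 r(1)] r(2) by simp
    then have "affine_map (2 * a + j) (- 1) x = x"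
      using 2 by simp
    then show ?thesis using reflection by blast
  next
    case True
    then obtain s where s: "preserves_connections s" "\<not> n dvd s - 1" "\<not> n dvd s + 1"
      using t by blast
    obtain t where t: "preserves_connections t" "\<not> n dvd t - 1" "n dvd t * j - j"
    proof (cases "n dvd s * j - j")
      case True
      then show thesis using s that by blast
    next
      case False
      then have "n dvd s * j + j" using s by (simp add: preserves_connections_def)
      moreover have "- s * j - j = - (s * j + j)" "- s - 1 = - (s + 1)" by simp_all
      ultimately show thesis
        using that[of "- s"] preserves_connections_uminus[OF s(1)] s(3) by (metis dvd_minus_iff)
    qed
    have "a - t * a + t * (a - t * a) = - ((t * t - 1) * a)" by (simp add: algebra_simps)
    then have "automorphism G (affine_map (a - t * a) t)"
      using t preserves_connections_square by (intro automorphism_affine_map) auto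
    moreover have "affine_map (a - t * a) t x = x"
      using 2 t by (simp add: affine_map_path)
    ultimately show ?thesis using affine_map_ne_id t by blast
  qed
qed


section \<open>The stabilizer of the connection set\<close>

lemma plus_minus_eq_iff: "plus_minus n x = plus_minus n y \<longleftrightarrow> n dvd x - y \<or> n dvd x + y"
proof -
  have "- x mod n = - y mod n \<longleftrightarrow> n dvd x - y"
    by (metis mod_eq_dvd_iff minus_diff_eq dvd_minus_iff minus_diff_minus)
  moreover have "- x mod n = y mod n \<longleftrightarrow> n dvd x + y"
    by (metis mod_eq_dvd_iff dvd_minus_iff minus_add_distrib diff_conv_add_uminus)
  ultimately show ?thesis
    by (auto simp: plus_minus_def doubleton_eq_iff mod_eq_dvd_iff)
qed

lemma unit_stabilizer_eq:
  "unit_stabilizer n i j = {t. 0 \<le> t \<and> t < n \<and> preserves_connections t}"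
proof -
  have mult: "(\<lambda>x. t \<otimes>\<^bsub>residue_ring n\<^esub> x) ` plus_minus n x = plus_minus n (t * x)" for t x
    by (simp add: plus_minus_def residue_ring_def mod_mult_right_eq)
  have unit: "t \<in> Units (residue_ring n)" if "0 \<le> t" "t < n" "preserves_connections t" for t
  proof -
    have "(t * t) mod n = 1"
      using preserves_connections_square[OF that(3)] n_gt_4
      by (metis mod_eq_dvd_iff mod_pos_pos_trivial zero_le_one order_less_trans one_less_numeral_iff semiring_norm(76))
    then show ?thesis using that by (auto simp: Units_def residue_ring_def)
  qed
  have "0 \<le> t \<and> t < n" if "t \<in> Units (residue_ring n)" for t
    using that by (auto simp: Units_def residue_ring_def)
  then show ?thesis
    using unit unfolding unit_stabilizer_def mult plus_minus_eq_iff preserves_connections_def by blast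
qed

lemma unit_stabilizer_trivial_iff:
  "unit_stabilizer n i j = plus_minus n 1 \<longleftrightarrow>
     (\<forall>t. preserves_connections t \<longrightarrow> n dvd t - 1 \<or> n dvd t + 1)"
proof -
  have pm: "t \<in> plus_minus n 1 \<longleftrightarrow> n dvd t - 1 \<or> n dvd t + 1" if "0 \<le> t" "t < n" for t
  proof -
    have "t = t mod n" using that by simp
    then have "t \<in> plus_minus n 1 \<longleftrightarrow> t mod n = 1 mod n \<or> t mod n = (- 1) mod n"
      by (auto simp: plus_minus_def)
    then show ?thesis by (simp add: mod_eq_dvd_iff)
  qed
  have mod_iff: "n dvd (t mod n) * x - y \<longleftrightarrow> n dvd t * x - y" for t x y
    by (metis mod_eq_dvd_iff mod_mult_left_eq)
  have mod_iff': "n dvd (t mod n) * x + y \<longleftrightarrow> n dvd t * x + y" for t x y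
    using mod_iff[of t x "- y"] by simp
  have mod: "preserves_connections (t mod n) \<longleftrightarrow> preserves_connections t" for t
    by (simp add: preserves_connections_def mod_iff mod_iff')
  have mod1: "n dvd t mod n - 1 \<longleftrightarrow> n dvd t - 1" "n dvd t mod n + 1 \<longleftrightarrow> n dvd t + 1" for t
    using mod_iff[of t 1] mod_iff'[of t 1] by simp_all
  have sub: "plus_minus n 1 \<subseteq> unit_stabilizer n i j"
    using mod_n_bounds mod[of 1] mod[of "- 1"] preserves_connections_minus_1
    by (auto simp: plus_minus_def unit_stabilizer_eq) (simp add: preserves_connections_def)
  show ?thesis
  proof
    assume *: "unit_stabilizer n i j = plus_minus n 1"
    show "\<forall>t. preserves_connections t \<longrightarrow> n dvd t - 1 \<or> n dvd t + 1"
    proof (intro allI impI)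
      fix t assume "preserves_connections t"
      then have "t mod n \<in> plus_minus n 1"
        using mod_n_bounds mod unfolding *[symmetric] unit_stabilizer_eq by simp
      then show "n dvd t - 1 \<or> n dvd t + 1" using pm mod_n_bounds mod1 by simp
    qed
  next
    assume "\<forall>t. preserves_connections t \<longrightarrow> n dvd t - 1 \<or> n dvd t + 1"
    then have "unit_stabilizer n i j \<subseteq> plus_minus n 1" using pm unfolding unit_stabilizer_eq by blast
    then show "unit_stabilizer n i j = plus_minus n 1" using sub by blast
  qed
qed


section \<open>Vertex sets with trivial stabilizer\<close>

lemma units_iff_coprime: "0 < x \<Longrightarrow> x < n \<Longrightarrow> x \<in> Units (residue_ring n) \<longleftrightarrow> coprime x n"
proof -
  assume "0 < x" "x < n"
  interpret R: residues n "residue_ring n"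
    using n_gt_4 by unfold_locales auto
  show ?thesis using R.res_units_eq \<open>0 < x\<close> \<open>x < n\<close> by auto
qed

text \<open>
  If \<open>n = 2 (i + j)\<close>, then \<open>i\<close> and \<open>j\<close> are coprime, hence coprime to \<open>i + j\<close>. A common factor with \<open>n\<close>
  could only be \<open>2\<close>, which cannot divide both.
\<close>
lemma not_antipodal:
  assumes "\<not> coprime i n" "\<not> coprime j n"
  shows "2 * (i + j) \<noteq> n"
proof
  assume n: "2 * (i + j) = n"
  have "gcd i j dvd gcd n (gcd i j)" by (simp flip: n)
  then have ij: "coprime i j" using gcd_1 by (simp add: coprime_iff_gcd_eq_1)
  then have "coprime i (i + j)" "coprime j (i + j)"
    by (metis coprime_iff_gcd_eq_1 gcd.commute gcd_add1 gcd_add2)+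
  then have "even i" "even j"
    using assms unfolding n[symmetric] coprime_mult_right_iff by auto
  then show False using ij coprime_common_divisor[of i j 2] by simp
qed

lemma eq_id_of_affine:
  assumes \<phi>: "automorphism G \<phi>" "\<And>a. \<phi> (u a) = u (c + t * a)"
    and "n dvd c" "n dvd t - 1"
  shows "\<phi> = id"
proof (rule automorphism_id[OF \<phi>(1)])
  fix a
  have "c + t * a - a = c + (t - 1) * a" by (simp add: algebra_simps)
  then have "n dvd c + t * a - a" using assms by (metis dvd_add dvd_mult2)
  then show "\<phi> (u a) = u a" by (simp add: \<phi> u_eq_iff)
qed

text \<open>
  Since \<open>p \<ge> 2\<close>, reversing the path that starts at \<open>u\<^sub>0\<close> would move its first inner vertex, so the
  path is fixed pointwise. This leaves \<open>t j \<equiv> j\<close>, which excludes \<open>t \<equiv> - 1\<close>.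
\<close>
lemma determined_by_subdivision_vertex:
  assumes p: "p \<ge> 2" and connections: "i = 1 \<or> 2 * (i + j) \<noteq> n"
    and trivial: "\<forall>t. preserves_connections t \<longrightarrow> n dvd t - 1 \<or> n dvd t + 1"
    and \<phi>: "automorphism G \<phi>" and fixed: "\<phi> (path 0 1) = path 0 1"
  shows "\<phi> = id"
proof -
  obtain c t where t: "preserves_connections t" and u: "\<And>a. \<phi> (u a) = u (c + t * a)"
    using automorphism_affine[OF \<phi> connections] by blast
  have u0: "\<phi> (u 0) = u c" using u[of 0] by simp
  have "\<phi> (path 0 1) \<noteq> path (c - j) (Suc p - 1)"
    using fixed p path_eq_iff[of 1 p 0 "c - j"] by simp
  then have walk: "\<forall>r\<le>Suc p. \<phi> (path 0 r) = path c r"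
    using automorphism_path[OF \<phi> u0] p by (metis Suc_le_mono le0 One_nat_def)
  have "path c 1 = path 0 1" using walk fixed p by simp
  then have c: "n dvd c" using path_eq_iff[of 1 1 c 0] p by simp
  have "\<phi> (path 0 (Suc p)) = path c (Suc p)" using walk by blast
  then have "n dvd t * j - j" using u[of j] by (simp add: u_eq_iff algebra_simps)
  have "\<not> n dvd t + 1"
  proof
    assume "n dvd t + 1"
    have "2 * j = (t + 1) * j - (t * j - j)" by (simp add: algebra_simps)
    then have "n dvd 2 * j" using \<open>n dvd t + 1\<close> \<open>n dvd t * j - j\<close> by (metis dvd_diff dvd_mult2)
    then show False using connections_not_dvd by simp
  qed
  then have "n dvd t - 1" using trivial t by blast
  then show ?thesis using eq_id_of_affine[OF \<phi> u c] by blast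
qed

text \<open>
  By size, \<open>n dvd 2 i + j\<close> means \<open>n = 2 i + j\<close>. This makes \<open>i\<close> coprime to \<open>n\<close>, and \<open>i = 1\<close> would
  give \<open>j = n - 2 \<ge> n / 2\<close>.
\<close>
lemma not_dvd_double_plus:
  assumes "i = 1 \<or> \<not> coprime i n"
  shows "\<not> n dvd 2 * i + j"
proof
  assume "n dvd 2 * i + j"
  then have "n dvd 2 * i + j - n" by simp
  moreover have "\<bar>2 * i + j - n\<bar> < n" using i_pos i_less_j j_less by linarith
  ultimately have n: "n = 2 * i + j" by (simp add: dvd_small_iff)
  have "gcd i n dvd n - 2 * i" by (intro dvd_diff dvd_mult) simp_all
  then have "gcd i n dvd gcd n (gcd i j)" by (simp add: n)
  then have "coprime i n" using gcd_1 by (simp add: coprime_iff_gcd_eq_1)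
  moreover have "i \<noteq> 1" using n j_less i_less_j by linarith
  ultimately show False using assms by blast
qed

text \<open>
  The two vertices have different degrees, so both are fixed. If the path from \<open>i\<close> to \<open>i + j\<close> keeps its
  direction, then \<open>t\<close> fixes \<open>i\<close> and \<open>j\<close>. It cannot be reversed: that would mean \<open>t i \<equiv> i + j\<close>,
  which is neither \<open>i\<close> nor \<open>- i\<close>.
\<close>
lemma determined_by_two_vertices:
  assumes connections: "i = 1 \<or> 2 * (i + j) \<noteq> n" "i = 1 \<or> \<not> coprime i n"
    and \<phi>: "automorphism G \<phi>" and stable: "\<phi> ` {u 0, path i 1} = {u 0, path i 1}"
  shows "\<phi> = id"
proof -
  obtain c t where t: "preserves_connections t" and u: "\<And>a. \<phi> (u a) = u (c + t * a)"
    using automorphism_affine[OF \<phi> connections(1)] by blast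
  have inner: "path i 1 \<noteq> u b" for b using path_ne_u(1)[of 1] p_pos by simp
  have "\<phi> (u 0) \<in> {u 0, path i 1}" "\<phi> (path i 1) \<in> {u 0, path i 1}" using stable by blast+
  moreover have "\<phi> (u 0) \<noteq> path i 1" using u[of 0] inner by metis
  moreover have "\<phi> (path i 1) \<noteq> u 0" using automorphism_inner[OF \<phi>, of 1] p_pos by blast
  ultimately have "\<phi> (u 0) = u 0" and fixed: "\<phi> (path i 1) = path i 1" by blast+
  then have c: "n dvd c" using u[of 0] by (simp add: u_eq_iff)
  have u': "\<phi> (u a) = u (t * a)" for a using u c by (simp add: u_eq_iff)
  have "(\<forall>r\<le>Suc p. \<phi> (path i r) = path (t * i) r) \<or>
        (\<forall>r\<le>Suc p. \<phi> (path i r) = path (t * i - j) (Suc p - r))"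
    by (rule automorphism_path[OF \<phi> u'])
  then show ?thesis
  proof
    assume walk: "\<forall>r\<le>Suc p. \<phi> (path i r) = path (t * i) r"
    then have "path (t * i) 1 = path i 1" using fixed by simp
    then have ti: "n dvd t * i - i" using path_eq_iff[of 1 1 "t * i" i] p_pos by simp
    have "\<phi> (path i (Suc p)) = path (t * i) (Suc p)" using walk by blast
    then have "n dvd t * j - j" by (simp add: u' u_eq_iff algebra_simps)
    then have "n dvd t - 1" using ti dvd_cancel_connections[of "t - 1"] by (simp add: left_diff_distrib)
    then show ?thesis using eq_id_of_affine[OF \<phi> u c] by blast
  next
    assume walk: "\<forall>r\<le>Suc p. \<phi> (path i r) = path (t * i - j) (Suc p - r)"
    then have "\<phi> (path i 1) = path (t * i - j) (Suc p - 1)" using p_pos by auto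
    then have "path (t * i - j) p = path i 1" using fixed by simp
    then have ti: "n dvd t * i - j - i" using path_eq_iff[of p 1 "t * i - j" i] p_pos by simp
    from t have "n dvd t * i - i \<or> n dvd t * i + i" by (simp add: preserves_connections_def)
    then have "n dvd (t * i - i) - (t * i - j - i) \<or> n dvd (t * i + i) - (t * i - j - i)"
      by (rule disj_forward) (erule dvd_diff[OF _ ti])+
    then have "n dvd j \<or> n dvd 2 * i + j" by (simp add: algebra_simps)
    then show ?thesis using connections_not_dvd not_dvd_double_plus[OF connections(2)] by blast
  qed
qed

end

theorem theorem25:
  fixes n i j :: int and p :: nat
  assumes "0 < i" and "i < j" and "2 * j < n"
    and "gcd n (gcd i j) = 1"
    and "p \<ge> 1"
    and "i = 1 \<or> (i \<notin> Units (residue_ring n) \<and> j \<notin> Units (residue_ring n))"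
  shows
    "(p \<ge> 2 \<and> unit_stabilizer n i j = plus_minus n 1 \<longrightarrow>
        Det (subdivided_circulant n i j p) = 1 \<and>
        Dist (subdivided_circulant n i j p) = 2 \<and>
        cost (subdivided_circulant n i j p) = 1) \<and>
     (\<not> (p \<ge> 2 \<and> unit_stabilizer n i j = plus_minus n 1) \<longrightarrow>
        Det (subdivided_circulant n i j p) = 2 \<and>
        Dist (subdivided_circulant n i j p) = 2 \<and>
        cost (subdivided_circulant n i j p) = 2)"
proof -
  interpret subdivided_circulant_graph n i j p
    using assms by unfold_locales
  have units: "i = 1 \<or> \<not> coprime i n \<and> \<not> coprime j n"
    using assms units_iff_coprime[of i] units_iff_coprime[of j] by auto
  then have connections: "i = 1 \<or> 2 * (i + j) \<noteq> n"
    using not_antipodal by blast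
  have parameters: "Det G = card W \<and> Dist G = 2 \<and> cost G = card W"
    if "W \<subseteq> verts G" "\<And>\<phi>. automorphism G \<phi> \<Longrightarrow> \<phi> ` W = W \<Longrightarrow> \<phi> = id"
      "\<And>S. determining_set G S \<Longrightarrow> card W \<le> card S" for W
    using Det_Dist_cost_eqI[OF finite_verts that reflection] by blast
  show ?thesis
  proof (intro conjI impI)
    assume *: "p \<ge> 2 \<and> unit_stabilizer n i j = plus_minus n 1"
    have "card S \<ge> 1" if "determining_set G S" for S
    proof -
      have "S \<noteq> {}" using that reflection by (auto simp: determining_set_def)
      moreover have "finite S" using that finite_verts by (auto simp: determining_set_def intro: finite_subset)
      ultimately show ?thesis by (simp add: Suc_leI card_gt_0_iff)
    qed
    then have "Det G = card {path 0 1} \<and> Dist G = 2 \<and> cost G = card {path 0 1}"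
      using * connections determined_by_subdivision_vertex p_pos
      by (intro parameters) (auto simp: unit_stabilizer_trivial_iff)
    then show "Det G = 1" "Dist G = 2" "cost G = 1" by simp_all
  next
    assume *: "\<not> (p \<ge> 2 \<and> unit_stabilizer n i j = plus_minus n 1)"
    have card: "card {u 0, path i 1} = 2"
      using path_ne_u[of 1] p_pos by simp
    have "verts G \<noteq> {}" using u_in_verts by blast
    then have "card S \<ge> 2" if "determining_set G S" for S
      using card_determining_set_ge_2[OF finite_verts _ _ that] nontrivial_fixing_vertex *
      by (simp add: unit_stabilizer_trivial_iff)
    then have "Det G = card {u 0, path i 1} \<and> Dist G = 2 \<and> cost G = card {u 0, path i 1}"
      using connections units determined_by_two_vertices p_pos card
      by (intro parameters) auto
    then show "Det G = 2" "Dist G = 2" "cost G = 2" using card by simp_all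
  qed
qed

end
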